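(* For every $n\geq 1$, the chromatic number $\alpha_n$ of the $n$-dimensional associahedron (with respect to proper colourings of its facets) is $$\alpha_n=\sum_{i=2}^{\lceil n/2\rceil+1}A_i,$$ where the integers $A_i,B_i$, $2\leq i\leq\lceil n/2\rceil+1$ (depending on $n$), are defined recursively by $$B_i=\begin{cases}0 & \text{if } i=2,\\ n+3+B_{i-1}-(i-1)A_{i-1} & \text{if } 2<i\leq\lceil n/2\rceil+1,\end{cases}$$ $$A_i=\begin{cases}\left\lceil\frac{n+3+B_i}{i}\right\rceil & \text{if } n \text{ is even or } i\leq\lceil n/2\rceil,\\ 1 & \text{if } n \text{ is odd and } i=\lceil n/2\rceil+1.\end{cases}$$
   Context: For $n\geq 1$ let $[n]=\{1,\ldots,n\}$ and $[n]_0=\{0,1,\ldots,n\}$. A building set is a collection $\mathcal{B}$ of nonempty subsets of $[n]_0$ containing all singletons $\{x\}$, $x\in[n]_0$, such that $S_1,S_2\in\mathcal{B}$ and $S_1\cap S_2\neq\emptyset$ imply $S_1\cup S_2\in\mathcal{B}$. For a family of sets $N$, an $N$-antichain is a subset $\{X_1,\ldots,X_m\}\subseteq N$ with $m\geq 2$ whose members are mutually incomparable with respect to $\subseteq$. Assuming $[n]_0\in\mathcal{B}$, a set $N\subseteq\mathcal{B}$ is nested when the union of every $N$-antichain is not an element of $\mathcal{B}$. The nested-set complex of $\mathcal{B}$ is the simplicial complex of all nested sets $N$ with $[n]_0\notin N$. It is realised by a simple $n$-dimensional polytope (the nestohedron of $\mathcal{B}$): its face lattice with the bottom (the empty face) removed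 is isomorphic to the complex ordered by $\supseteq$. Hence its facets are identified with the elements $X\in\mathcal{B}$, $X\neq[n]_0$, and two facets have a common vertex iff some nested set contains both. The $n$-dimensional associahedron is the nestohedron of the building set of all nonempty connected subsets of vertices of the path $0-1-\cdots-n$, i.e. of all sets $[a,b]=\{x\in[n]_0\mid a\leq x\leq b\}$ with $0\leq a\leq b\leq n$. Its facets are identified with those $[a,b]$ that are proper subsets of $[n]_0$. Two facets of a polytope are separated when they have no vertex in common. For $\mathcal{F}$ the set of facets of a polytope, a function $f\colon\mathcal{F}\to[m]$ is a proper colouring when every two (distinct) facets of the same colour are separated. The chromatic number of the polytope is the minimal $m$ such that a proper colouring of its facets with $m$ colours exists. *)

theory Defs
  imports "HOL-Analysis.Analysis"
begin

section \<open>Building sets and nested sets\<close>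

text \<open>The ground set $[n]_0$ is \<open>{0..n}\<close> throughout.\<close>

definition building_set :: "nat \<Rightarrow> nat set set \<Rightarrow> bool" where
  "building_set n \<B> \<longleftrightarrow>
     (\<forall>S\<in>\<B>. S \<noteq> {} \<and> S \<subseteq> {0..n}) \<and>
     (\<forall>x\<in>{0..n}. {x} \<in> \<B>) \<and>
     (\<forall>S\<^sub>1\<in>\<B>. \<forall>S\<^sub>2\<in>\<B>. S\<^sub>1 \<inter> S\<^sub>2 \<noteq> {} \<longrightarrow> S\<^sub>1 \<union> S\<^sub>2 \<in> \<B>)"

text \<open>Antichains are finite with at least two members; \<open>2 \<le> card \<A>\<close> already implies finiteness.\<close>

definition antichain_in :: "'a set set \<Rightarrow> 'a set set \<Rightarrow> bool" where
  "antichain_in N \<A> \<longleftrightarrow>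
     \<A> \<subseteq> N \<and> 2 \<le> card \<A> \<and> (\<forall>X\<in>\<A>. \<forall>Y\<in>\<A>. X \<noteq> Y \<longrightarrow> \<not> X \<subseteq> Y \<and> \<not> Y \<subseteq> X)"

definition nested :: "nat set set \<Rightarrow> nat set set \<Rightarrow> bool" where
  "nested \<B> N \<longleftrightarrow> N \<subseteq> \<B> \<and> (\<forall>\<A>. antichain_in N \<A> \<longrightarrow> \<Union>\<A> \<notin> \<B>)"

definition nested_set_complex :: "nat \<Rightarrow> nat set set \<Rightarrow> nat set set set" where
  "nested_set_complex n \<B> = {N. nested \<B> N \<and> {0..n} \<notin> N}"


section \<open>Nestohedra\<close>

definition simple_polytope :: "'a::euclidean_space set \<Rightarrow> bool" where
  "simple_polytope P \<longleftrightarrow> polytope P \<and>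
     (\<forall>v. v extreme_point_of P \<longrightarrow> int (card {F. F facet_of P \<and> v \<in> F}) = aff_dim P)"

text \<open>
  A nestohedron is determined only up to combinatorial equivalence, so ``\<open>P\<close> is the
  nestohedron of \<open>\<B>\<close>'' is a predicate of a polytope \<open>P\<close> in some Euclidean space. The library's
  \<open>face_of\<close> counts both the empty set and \<open>P\<close> itself as faces of \<open>P\<close>; the face \<open>P\<close>
  corresponds to the empty nested set.
\<close>

definition nestohedron :: "nat \<Rightarrow> nat set set \<Rightarrow> 'a::euclidean_space set \<Rightarrow> bool" where
  "nestohedron n \<B> P \<longleftrightarrow>
     simple_polytope P \<and> aff_dim P = int n \<and>
     (\<exists>\<phi>. bij_betw \<phi> {F. F face_of P \<and> F \<noteq> {}} (nested_set_complex n \<B>) \<and>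
        (\<forall>F G. F face_of P \<and> F \<noteq> {} \<and> G face_of P \<and> G \<noteq> {} \<longrightarrow>
           (F \<subseteq> G \<longleftrightarrow> \<phi> G \<subseteq> \<phi> F)))"

text \<open>
  The same polytope seen through its face lattice alone: facets are the members of \<open>\<B>\<close> other than
  the ground set, vertices are the maximal members of the complex, and a vertex \<open>N\<close> lies
  on the facet \<open>X\<close> iff \<open>X \<in> N\<close>.
\<close>

definition nestohedron_facets :: "nat \<Rightarrow> nat set set \<Rightarrow> nat set set" where
  "nestohedron_facets n \<B> = {X \<in> \<B>. X \<noteq> {0..n}}"

definition nestohedron_vertices :: "nat \<Rightarrow> nat set set \<Rightarrow> nat set set set" where
  "nestohedron_vertices n \<B> =
     {N \<in> nested_set_complex n \<B>. \<forall>M \<in> nested_set_complex n \<B>. N \<subseteq> M \<longrightarrow> M = N}"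


section \<open>The associahedron\<close>

text \<open>The nonempty connected vertex sets of the path $0 - 1 - \cdots - n$.\<close>

definition path_building_set :: "nat \<Rightarrow> nat set set" where
  "path_building_set n = {{a..b} | a b. a \<le> b \<and> b \<le> n}"

lemma building_set_path: "building_set n (path_building_set n)"
  unfolding building_set_def
proof (intro conjI ballI impI)
  fix S assume "S \<in> path_building_set n"
  then show "S \<noteq> {}" "S \<subseteq> {0..n}"
    by (auto simp: path_building_set_def)
next
  fix x assume "x \<in> {0..n}"
  then show "{x} \<in> path_building_set n"
    unfolding path_building_set_def by (auto intro!: exI[of _ x])
next
  fix S T assume "S \<in> path_building_set n" "T \<in> path_building_set n" and ne: "S \<inter> T \<noteq> {}"
  then obtain a b c d where S: "S = {a..b}" "a \<le> b" "b \<le> n" and T: "T = {c..d}" "c \<le> d" "d \<le> n"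
    by (auto simp: path_building_set_def)
  have "S \<union> T = {min a c..max b d}"
    using ne S T by (auto simp: min_def max_def)
  then show "S \<union> T \<in> path_building_set n"
    using S T unfolding path_building_set_def
    by (intro CollectI exI[of _ "min a c"] exI[of _ "max b d"]) auto
qed

lemma ground_in_path_building_set: "{0..n} \<in> path_building_set n"
  by (auto simp: path_building_set_def)

definition associahedron :: "nat \<Rightarrow> 'a::euclidean_space set \<Rightarrow> bool" where
  "associahedron n P \<longleftrightarrow> nestohedron n (path_building_set n) P"


section \<open>Proper colourings\<close>

definition separated_facets :: "'a::euclidean_space set \<Rightarrow> 'a set \<Rightarrow> 'a set \<Rightarrow> bool" where
  "separated_facets P F G \<longleftrightarrow> \<not> (\<exists>v. v extreme_point_of P \<and> v \<in> F \<and> v \<in> G)"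

definition separated_nested :: "nat \<Rightarrow> nat set set \<Rightarrow> nat set \<Rightarrow> nat set \<Rightarrow> bool" where
  "separated_nested n \<B> X Y \<longleftrightarrow> \<not> (\<exists>N \<in> nestohedron_vertices n \<B>. X \<in> N \<and> Y \<in> N)"

definition proper_colouring ::
    "'f set \<Rightarrow> ('f \<Rightarrow> 'f \<Rightarrow> bool) \<Rightarrow> nat \<Rightarrow> ('f \<Rightarrow> nat) \<Rightarrow> bool" where
  "proper_colouring \<F> sep m f \<longleftrightarrow>
     f \<in> \<F> \<rightarrow> {1..m} \<and> (\<forall>X\<in>\<F>. \<forall>Y\<in>\<F>. X \<noteq> Y \<and> f X = f Y \<longrightarrow> sep X Y)"

text \<open>A finite set of facets always has a proper colouring, so the minimum below exists.\<close>

definition chromatic_number :: "'f set \<Rightarrow> ('f \<Rightarrow> 'f \<Rightarrow> bool) \<Rightarrow> nat" where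
  "chromatic_number \<F> sep = (LEAST m. \<exists>f. proper_colouring \<F> sep m f)"

definition polytope_chromatic_number :: "'a::euclidean_space set \<Rightarrow> nat" where
  "polytope_chromatic_number P = chromatic_number {F. F facet_of P} (separated_facets P)"

definition nestohedron_chromatic_number :: "nat \<Rightarrow> nat set set \<Rightarrow> nat" where
  "nestohedron_chromatic_number n \<B> =
     chromatic_number (nestohedron_facets n \<B>) (separated_nested n \<B>)"


section \<open>The recursion\<close>

text \<open>
  The sequences are integer valued, as the \<open>B\<^sub>i\<close> may be negative. Only the indices
  \<open>2 \<le> i \<le> \<lceil>n/2\<rceil> + 1\<close> are meaningful; values elsewhere are arbitrary.
\<close>

function seqA :: "nat \<Rightarrow> nat \<Rightarrow> int" and seqB :: "nat \<Rightarrow> nat \<Rightarrow> int" where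
  "seqA n i =
     (if even n \<or> int i \<le> \<lceil>real n / 2\<rceil>
      then \<lceil>(real n + 3 + real_of_int (seqB n i)) / real i\<rceil>
      else 1)"
| "seqB n i =
     (if i \<le> 2 then 0
      else int n + 3 + seqB n (i - 1) - (int i - 1) * seqA n (i - 1))"
  by pat_completeness auto
termination
  by (relation "Wellfounded.measure (\<lambda>x. case x of Inl (n, i) \<Rightarrow> 2 * i + 1 | Inr (n, i) \<Rightarrow> 2 * i)") auto

declare seqA.simps [simp del] seqB.simps [simp del]

end

theory Submission
  imports Defs
begin

text \<open>
  Write \<open>N = n + 3\<close>. A facet \<open>{a..b}\<close> of the associahedron is the diagonal joining the vertices
  \<open>a\<close> and \<open>b + 2\<close> of a convex \<open>N\<close>-gon with vertices \<open>0, \<dots>, n + 2\<close>, and two facets are separated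
  exactly when their diagonals cross in the interior. So the chromatic number is the least number of
  families of pairwise crossing diagonals into which all diagonals can be partitioned. The
  face lattice of a polytope determines which facets are separated, so it is enough to count for the
  complex of nested sets (\<open>polytope_chromatic_number_nestohedron\<close>,
  \<open>associahedron_chromatic_number_diagonals\<close>).

  Let the length of a diagonal be the number of sides of the polygon on its shorter side. There are
  \<open>N\<close> diagonals of each length \<open>i\<close> with \<open>2 \<le> i < N/2\<close>, and \<open>N/2\<close> of length \<open>N/2\<close> if \<open>N\<close> is even.

  Lower bound. A diagonal of length \<open>i\<close> has only \<open>i - 1\<close> vertices on its shorter side, and
  pairwise crossing diagonals share no endpoint, so a family containing it has at most \<open>i\<close> members
  (\<open>crossing_family_card\<close>). Thus if \<open>a\<^sub>i\<close> colours have \<open>i\<close> as their shortest length, then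
  \<open>2 a\<^sub>2 + \<dots> + i a\<^sub>i\<close> is at least the number of diagonals of length at most \<open>i\<close>, for every \<open>i\<close>.
  Choosing \<open>a\<^sub>2, a\<^sub>3, \<dots>\<close> greedily minimises the number of colours under these constraints
  (\<open>colours_lower_bound\<close>), and \<open>seqA n\<close> is that greedy choice (\<open>seqA_greedy\<close>): \<open>seqB n i\<close>, never
  positive, is minus the number of places for longer diagonals left over after length \<open>i - 1\<close>.

  Upper bound. List all diagonals by increasing length, and those of one length in the order of
  their starting vertices, going once around the polygon. Starting vertices then advance
  by one at every step of the whole list, even where the length changes. Hence any \<open>i\<close> consecutive
  entries beginning with a diagonal of length \<open>i\<close> cross pairwise (\<open>crossing_nth_diagonal\<close>), and
  cutting the list greedily into such blocks attains the lower bound (\<open>greedy_blocks\<close>).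
\<close>

section \<open>Chromatic numbers under isomorphism
\<close>

lemma proper_colouring_transfer:
  assumes "bij_betw h X Y"
    and "\<And>x x'. x \<in> X \<Longrightarrow> x' \<in> X \<Longrightarrow> x \<noteq> x' \<Longrightarrow> s (h x) (h x') \<Longrightarrow> r x x'"
    and "proper_colouring Y s m f"
  shows "proper_colouring X r m (f \<circ> h)"
proof -
  have inj: "inj_on h X" and im: "h ` X = Y"
    using assms(1) by (auto simp: bij_betw_def)
  show ?thesis
    unfolding proper_colouring_def
  proof (intro conjI ballI impI)
    show "f \<circ> h \<in> X \<rightarrow> {1..m}"
      using assms(3) im by (auto simp: proper_colouring_def)
  next
    fix x x' assume x: "x \<in> X" "x' \<in> X" "x \<noteq> x' \<and> (f \<circ> h) x = (f \<circ> h) x'"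
    then have "h x \<noteq> h x'" "h x \<in> Y" "h x' \<in> Y"
      using inj im by (auto dest: inj_onD)
    then have "s (h x) (h x')"
      using x assms(3) by (auto simp: proper_colouring_def)
    then show "r x x'" using assms(2) x by blast
  qed
qed

lemma chromatic_number_bij_betw:
  assumes bij: "bij_betw h X Y"
    and iff: "\<And>x x'. x \<in> X \<Longrightarrow> x' \<in> X \<Longrightarrow> x \<noteq> x' \<Longrightarrow> r x x' \<longleftrightarrow> s (h x) (h x')"
  shows "chromatic_number X r = chromatic_number Y s"
proof -
  let ?k = "the_inv_into X h"
  have bij': "bij_betw ?k Y X"
    using bij by (rule bij_betw_the_inv_into)
  have hk: "h (?k y) = y" "?k y \<in> X" if "y \<in> Y" for y
    using that bij bij' by (auto simp: bij_betw_def f_the_inv_into_f)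
  have "(\<exists>f. proper_colouring X r m f) \<longleftrightarrow> (\<exists>f. proper_colouring Y s m f)" for m
  proof
    assume "\<exists>f. proper_colouring X r m f"
    then obtain f where f: "proper_colouring X r m f" ..
    have "proper_colouring Y s m (f \<circ> ?k)"
      by (rule proper_colouring_transfer[OF bij' _ f]) (metis hk iff)
    then show "\<exists>f. proper_colouring Y s m f" by blast
  next
    assume "\<exists>f. proper_colouring Y s m f"
    then obtain f where f: "proper_colouring Y s m f" ..
    have "proper_colouring X r m (f \<circ> h)"
      by (rule proper_colouring_transfer[OF bij _ f]) (simp add: iff)
    then show "\<exists>f. proper_colouring X r m f" by blast
  qed
  then show ?thesis by (simp add: chromatic_number_def)
qed

section \<open>Realisations of nested-set complexes\<close>

lemma nested_subset: "nested \<B> N \<Longrightarrow> M \<subseteq> N \<Longrightarrow> nested \<B> M"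
  unfolding nested_def antichain_in_def by (meson subset_trans)

lemma finite_building_set: "building_set n \<B> \<Longrightarrow> finite \<B>"
  by (rule finite_subset[of _ "Pow {0..n}"]) (auto simp: building_set_def)

text \<open>
  The complex is finite, so each of its members extends to a maximal one; a common vertex therefore
  exists as soon as any member of the complex contains both facets.
\<close>

lemma separated_nested_iff:
  assumes "building_set n \<B>"
  shows "separated_nested n \<B> X Y \<longleftrightarrow> \<not> (\<exists>N \<in> nested_set_complex n \<B>. X \<in> N \<and> Y \<in> N)"
proof -
  have "finite (nested_set_complex n \<B>)"
    by (rule finite_subset[of _ "Pow \<B>"])
      (auto simp: nested_set_complex_def nested_def finite_building_set[OF assms])
  then have max: "\<exists>M \<in> nestohedron_vertices n \<B>. N \<subseteq> M" if N: "N \<in> nested_set_complex n \<B>" for N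
  proof -
    obtain M where "M \<in> nested_set_complex n \<B>" "N \<subseteq> M"
      "\<forall>M' \<in> nested_set_complex n \<B>. M \<subseteq> M' \<longrightarrow> M = M'"
      using finite_has_maximal2[OF \<open>finite (nested_set_complex n \<B>)\<close> N] by metis
    then have "M \<in> nestohedron_vertices n \<B>" unfolding nestohedron_vertices_def by blast
    with \<open>N \<subseteq> M\<close> show ?thesis ..
  qed
  have "(\<exists>N \<in> nestohedron_vertices n \<B>. X \<in> N \<and> Y \<in> N) \<longleftrightarrow>
        (\<exists>N \<in> nested_set_complex n \<B>. X \<in> N \<and> Y \<in> N)"
  proof
    assume "\<exists>N \<in> nestohedron_vertices n \<B>. X \<in> N \<and> Y \<in> N"
    then show "\<exists>N \<in> nested_set_complex n \<B>. X \<in> N \<and> Y \<in> N"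
      unfolding nestohedron_vertices_def by blast
  next
    assume "\<exists>N \<in> nested_set_complex n \<B>. X \<in> N \<and> Y \<in> N"
    then obtain N where N: "N \<in> nested_set_complex n \<B>" "X \<in> N" "Y \<in> N" by (elim bexE conjE)
    obtain M where "M \<in> nestohedron_vertices n \<B>" "N \<subseteq> M" using max[OF N(1)] by (elim bexE)
    then show "\<exists>N \<in> nestohedron_vertices n \<B>. X \<in> N \<and> Y \<in> N"
      by (intro bexI[of _ M] conjI subsetD[OF \<open>N \<subseteq> M\<close>] N) auto
  qed
  then show ?thesis by (simp add: separated_nested_def)
qed

text \<open>
  A nonempty face of a polytope contains an extreme point, which is also extreme in the
  whole polytope. This expresses separation by the order of faces alone, so that an isomorphism of face
  lattices can transport it.
\<close>

lemma separated_facets_iff: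
  assumes "polytope P" "F face_of P" "G face_of P"
  shows "separated_facets P F G \<longleftrightarrow> \<not> (\<exists>H. H face_of P \<and> H \<noteq> {} \<and> H \<subseteq> F \<and> H \<subseteq> G)"
proof -
  have "(\<exists>v. v extreme_point_of P \<and> v \<in> F \<and> v \<in> G) \<longleftrightarrow>
        (\<exists>H. H face_of P \<and> H \<noteq> {} \<and> H \<subseteq> F \<and> H \<subseteq> G)" (is "?l \<longleftrightarrow> ?r")
  proof
    assume ?l
    then obtain v where v: "v extreme_point_of P" "v \<in> F" "v \<in> G" by (elim exE conjE)
    show ?r
      by (rule exI[of _ "{v}"]) (use v in \<open>simp add: face_of_singleton\<close>)
  next
    assume ?r
    then obtain H where H: "H face_of P" "H \<noteq> {}" "H \<subseteq> F" "H \<subseteq> G" by blast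
    have "polytope H" using assms(1) H(1) by (rule face_of_polytope_polytope)
    then have "compact H" "convex H"
      by (auto simp: polytope_imp_compact polytope_imp_convex)
    then obtain v where v: "v extreme_point_of H"
      using extreme_point_exists_convex H(2) by blast
    then have "v extreme_point_of P" "v \<in> H"
      using extreme_point_of_face[OF H(1)] by auto
    then show ?l using H by blast
  qed
  then show ?thesis by (simp add: separated_facets_def)
qed

text \<open>
  The order-reversing bijection sends the whole polytope to the empty nested set. The facets are
  the maximal proper faces, so they go to the minimal nonempty nested sets, which are the singletons
  because every subset of a nested set is nested.
\<close>

lemma nestohedron_facet_bijection:
  fixes P :: "'a::euclidean_space set"
  assumes "nestohedron n \<B> P" "building_set n \<B>"
  obtains h where "bij_betw h {F. F facet_of P} (nestohedron_facets n \<B>)"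
    and "\<And>F G. F facet_of P \<Longrightarrow> G facet_of P \<Longrightarrow>
           separated_facets P F G \<longleftrightarrow> separated_nested n \<B> (h F) (h G)"
proof -
  let ?K = "nested_set_complex n \<B>"
  let ?\<F> = "{F. F face_of P \<and> F \<noteq> {}}"
  have P: "polytope P" "aff_dim P = int n"
    using assms(1) by (auto simp: nestohedron_def simple_polytope_def)
  have Pne: "P \<noteq> {}" using P(2) by auto
  have Pface: "P face_of P" using P(1) by (simp add: face_of_refl polytope_imp_convex)
  obtain \<phi> where bij: "bij_betw \<phi> ?\<F> ?K"
    and ord: "\<And>F G. F \<in> ?\<F> \<Longrightarrow> G \<in> ?\<F> \<Longrightarrow> F \<subseteq> G \<longleftrightarrow> \<phi> G \<subseteq> \<phi> F"
    using assms(1) by (auto simp: nestohedron_def)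
  have \<phi>K: "\<phi> F \<in> ?K" if "F \<in> ?\<F>" for F
    by (rule bspec[OF bij_betwE[OF bij] that])
  have surj: "\<exists>F\<in>?\<F>. \<phi> F = N" if "N \<in> ?K" for N
  proof -
    have "N \<in> \<phi> ` ?\<F>" using that by (simp only: bij_betw_imp_surj_on[OF bij])
    then show ?thesis by (auto simp only: image_iff)
  qed
  have inj: "F = G" if "F \<in> ?\<F>" "G \<in> ?\<F>" "\<phi> F = \<phi> G" for F G
    by (rule inj_onD[OF bij_betw_imp_inj_on[OF bij] that(3,1,2)])
  have sub: "M \<in> ?K" if "N \<in> ?K" "M \<subseteq> N" for M N
    using that nested_subset[of \<B> N M] by (auto simp: nested_set_complex_def)
  have singleton: "{X} \<in> ?K \<longleftrightarrow> X \<in> nestohedron_facets n \<B>" for X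
  proof -
    have "\<not> antichain_in {X} \<A>" for \<A>
      using card_mono[of "{X}" \<A>] by (auto simp: antichain_in_def)
    then show ?thesis
      by (auto simp: nested_set_complex_def nested_def nestohedron_facets_def)
  qed
  have empty: "{} \<in> ?K"
    by (auto simp: nested_set_complex_def nested_def antichain_in_def)
  have \<phi>P: "\<phi> P = {}"
  proof -
    obtain F where F: "F \<in> ?\<F>" "\<phi> F = {}" by (rule bexE[OF surj[OF empty]])
    then have "F \<subseteq> P" by (auto dest: face_of_imp_subset)
    then show ?thesis using ord[of F P] F Pne Pface by auto
  qed
  have facet\<F>: "F \<in> ?\<F>" "F \<noteq> P" if "F facet_of P" for F
    using that by (auto simp: facet_of_def)
  have ne: "\<phi> F \<noteq> {}" if "F \<in> ?\<F>" "F \<noteq> P" for F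
    using inj[of F P] that \<phi>P Pne Pface by auto
  have facet_single: "\<exists>X. \<phi> F = {X}" if F: "F facet_of P" for F
  proof -
    obtain X where X: "X \<in> \<phi> F" using ne facet\<F>[OF F] by blast
    then have "{X} \<in> ?K" by (intro sub[OF \<phi>K[OF facet\<F>(1)[OF F]]]) simp
    then obtain G where G: "G \<in> ?\<F>" "\<phi> G = {X}" by (rule bexE[OF surj])
    have "F \<subseteq> G" using ord[of F G] G X facet\<F>[OF F] by auto
    moreover have "G \<noteq> P" using G \<phi>P by auto
    ultimately have "aff_dim G < aff_dim P"
      using G(1) P(1) face_of_aff_dim_lt[of P G] by (simp add: polytope_imp_convex)
    \<comment> \<open>\<open>F\<close> already has codimension one, which leaves no room for a strictly larger proper face.\<close>
    have "F = G"
    proof (rule ccontr)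
      assume "F \<noteq> G"
      have "polytope G" using G(1) face_of_polytope_polytope[OF P(1), of G] by simp
      moreover have "F face_of G"
        using facet_of_imp_face_of[OF F] \<open>F \<subseteq> G\<close> face_of_imp_subset[of G P] G(1)
        by (intro face_of_subset[of F P G]) auto
      ultimately have "aff_dim F < aff_dim G"
        using \<open>F \<noteq> G\<close> face_of_aff_dim_lt[of G F] by (simp add: polytope_imp_convex)
      then show False using \<open>aff_dim G < aff_dim P\<close> F by (simp add: facet_of_def)
    qed
    then show ?thesis using G by auto
  qed
  have single_facet: "F facet_of P" if F: "F \<in> ?\<F>" "\<phi> F = {X}" for F X
  proof -
    have "F \<noteq> P" using F \<phi>P by auto
    then obtain G where G: "G facet_of P" "F \<subseteq> G"
      using face_of_polyhedron_subset_facet[of P F] F P(1) by (auto simp: polytope_imp_polyhedron)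
    then have "\<phi> G \<subseteq> {X}" using ord[of F G] F facet\<F>[OF G(1)] by auto
    moreover have "\<phi> G \<noteq> {}" by (intro ne facet\<F>[OF G(1)])
    ultimately have "\<phi> G = \<phi> F" using F(2) by (simp add: subset_singleton_iff)
    then have "G = F" by (intro inj facet\<F>(1)[OF G(1)] F(1))
    then show ?thesis using G(1) by simp
  qed
  define h where "h = (\<lambda>F. the_elem (\<phi> F))"
  have \<phi>h: "\<phi> F = {h F}" if "F facet_of P" for F
    using facet_single[OF that] by (auto simp: h_def)
  have "bij_betw h {F. F facet_of P} (nestohedron_facets n \<B>)"
    unfolding bij_betw_def
  proof
    show "inj_on h {F. F facet_of P}"
    proof (rule inj_onI)
      fix F G assume "F \<in> {F. F facet_of P}" "G \<in> {F. F facet_of P}" "h F = h G"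
      then show "F = G" by (intro inj facet\<F>(1)) (auto simp: \<phi>h)
    qed
    show "h ` {F. F facet_of P} = nestohedron_facets n \<B>"
    proof
      show "h ` {F. F facet_of P} \<subseteq> nestohedron_facets n \<B>"
      proof (rule image_subsetI)
        fix F assume "F \<in> {F. F facet_of P}"
        then have F: "F facet_of P" by simp
        have "{h F} \<in> ?K" using \<phi>K[OF facet\<F>(1)[OF F]] by (simp add: \<phi>h[OF F])
        then show "h F \<in> nestohedron_facets n \<B>" by (simp add: singleton)
      qed
      show "nestohedron_facets n \<B> \<subseteq> h ` {F. F facet_of P}"
      proof
        fix X assume "X \<in> nestohedron_facets n \<B>"
        then have "{X} \<in> ?K" by (simp add: singleton)
        then obtain F where F: "F \<in> ?\<F>" "\<phi> F = {X}" by (rule bexE[OF surj])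
        then have "F facet_of P" by (rule single_facet)
        moreover have "h F = X" using F by (simp add: h_def)
        ultimately show "X \<in> h ` {F. F facet_of P}" by blast
      qed
    qed
  qed
  moreover have "separated_facets P F G \<longleftrightarrow> separated_nested n \<B> (h F) (h G)"
    if FG: "F facet_of P" "G facet_of P" for F G
  proof -
    have incidence: "H \<subseteq> F \<and> H \<subseteq> G \<longleftrightarrow> h F \<in> \<phi> H \<and> h G \<in> \<phi> H" if "H \<in> ?\<F>" for H
      using ord[OF that facet\<F>(1)[OF FG(1)]] ord[OF that facet\<F>(1)[OF FG(2)]]
      by (simp add: \<phi>h[OF FG(1)] \<phi>h[OF FG(2)])
    have "(\<exists>H. H face_of P \<and> H \<noteq> {} \<and> H \<subseteq> F \<and> H \<subseteq> G) \<longleftrightarrow>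
          (\<exists>H\<in>?\<F>. H \<subseteq> F \<and> H \<subseteq> G)"
      by simp
    also have "\<dots> \<longleftrightarrow> (\<exists>H\<in>?\<F>. h F \<in> \<phi> H \<and> h G \<in> \<phi> H)"
      by (rule bex_cong[OF refl incidence])
    also have "\<dots> \<longleftrightarrow> (\<exists>N\<in>?K. h F \<in> N \<and> h G \<in> N)"
    proof
      assume "\<exists>H\<in>?\<F>. h F \<in> \<phi> H \<and> h G \<in> \<phi> H"
      then obtain H where "H \<in> ?\<F>" "h F \<in> \<phi> H" "h G \<in> \<phi> H" by (elim bexE conjE)
      then show "\<exists>N\<in>?K. h F \<in> N \<and> h G \<in> N" by (intro bexI[OF _ \<phi>K] conjI)
    next
      assume "\<exists>N\<in>?K. h F \<in> N \<and> h G \<in> N"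
      then obtain N where N: "N \<in> ?K" "h F \<in> N" "h G \<in> N" by (elim bexE conjE)
      obtain H where "H \<in> ?\<F>" "\<phi> H = N" by (rule bexE[OF surj[OF N(1)]])
      then show "\<exists>H\<in>?\<F>. h F \<in> \<phi> H \<and> h G \<in> \<phi> H"
        using N by (intro bexI[of _ H]) simp_all
    qed
    finally show ?thesis
      using FG by (simp add: separated_nested_iff[OF assms(2)] separated_facets_iff[OF P(1)] facet_of_def)
  qed
  ultimately show thesis by (rule that)
qed

lemma polytope_chromatic_number_nestohedron:
  assumes "nestohedron n \<B> P" "building_set n \<B>"
  shows "polytope_chromatic_number P = nestohedron_chromatic_number n \<B>"
proof -
  obtain h where h: "bij_betw h {F. F facet_of P} (nestohedron_facets n \<B>)"
    "\<And>F G. F facet_of P \<Longrightarrow> G facet_of P \<Longrightarrow>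
           separated_facets P F G \<longleftrightarrow> separated_nested n \<B> (h F) (h G)"
    by (rule nestohedron_facet_bijection[OF assms]) (rule that)
  show ?thesis
    unfolding polytope_chromatic_number_def nestohedron_chromatic_number_def
    using h by (intro chromatic_number_bij_betw[of h]) auto
qed

section \<open>Facets of the associahedron as diagonals of a polygon\<close>

text \<open>
  A diagonal is given by its endpoints \<open>a < e\<close> among the vertices \<open>0, \<dots>, n + 2\<close> of the polygon. The
  excluded pair \<open>(0, n + 2)\<close> is the side that closes the polygon; it corresponds to the ground set.
\<close>

definition diagonals :: "nat \<Rightarrow> (nat \<times> nat) set" where
  "diagonals n = {(a, e). a + 2 \<le> e \<and> e \<le> n + 2 \<and> (a, e) \<noteq> (0, n + 2)}"

definition crossing :: "nat \<times> nat \<Rightarrow> nat \<times> nat \<Rightarrow> bool" where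
  "crossing = (\<lambda>(a, e) (c, f). a < c \<and> c < e \<and> e < f \<or> c < a \<and> a < f \<and> f < e)"

text \<open>
  The only possible antichain inside \<open>{X, Y}\<close> is \<open>{X, Y}\<close> itself.
\<close>

lemma separated_nested_pair:
  assumes "building_set n \<B>" "X \<in> nestohedron_facets n \<B>" "Y \<in> nestohedron_facets n \<B>"
  shows "separated_nested n \<B> X Y \<longleftrightarrow> \<not> X \<subseteq> Y \<and> \<not> Y \<subseteq> X \<and> X \<union> Y \<in> \<B>"
proof -
  have XY: "X \<in> \<B>" "Y \<in> \<B>" "X \<noteq> {0..n}" "Y \<noteq> {0..n}"
    using assms by (auto simp: nestohedron_facets_def)
  have "(\<exists>N \<in> nested_set_complex n \<B>. X \<in> N \<and> Y \<in> N) \<longleftrightarrow> nested \<B> {X, Y}"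
  proof
    assume "\<exists>N \<in> nested_set_complex n \<B>. X \<in> N \<and> Y \<in> N"
    then obtain N where N: "N \<in> nested_set_complex n \<B>" "X \<in> N" "Y \<in> N" by (elim bexE conjE)
    then have "nested \<B> N" by (simp add: nested_set_complex_def)
    then show "nested \<B> {X, Y}" by (rule nested_subset) (simp add: N)
  next
    assume "nested \<B> {X, Y}"
    then have "{X, Y} \<in> nested_set_complex n \<B>"
      using XY(3,4) by (simp add: nested_set_complex_def eq_commute[of "{0..n}"])
    then show "\<exists>N \<in> nested_set_complex n \<B>. X \<in> N \<and> Y \<in> N" by (rule rev_bexI) simp
  qed
  also have "\<dots> \<longleftrightarrow> X \<subseteq> Y \<or> Y \<subseteq> X \<or> X \<union> Y \<notin> \<B>"
  proof
    assume N: "nested \<B> {X, Y}"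
    show "X \<subseteq> Y \<or> Y \<subseteq> X \<or> X \<union> Y \<notin> \<B>"
    proof (rule ccontr)
      assume *: "\<not> (X \<subseteq> Y \<or> Y \<subseteq> X \<or> X \<union> Y \<notin> \<B>)"
      then have "antichain_in {X, Y} {X, Y}"
        by (auto simp: antichain_in_def card_insert_if)
      then have "\<Union>{X, Y} \<notin> \<B>" by (rule mp[OF spec[OF conjunct2[OF N[unfolded nested_def]]]])
      then show False using * by simp
    qed
  next
    assume *: "X \<subseteq> Y \<or> Y \<subseteq> X \<or> X \<union> Y \<notin> \<B>"
    have "\<Union>\<A> \<notin> \<B>" if \<A>: "antichain_in {X, Y} \<A>" for \<A>
    proof -
      have "\<A> \<subseteq> {X, Y}" "2 \<le> card \<A>" using \<A> by (auto simp: antichain_in_def)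
      moreover from this have "card {X, Y} \<le> card \<A>"
        by (auto simp: card_insert_if)
      ultimately have eq: "\<A> = {X, Y}" by (intro card_seteq) auto
      moreover have "X \<noteq> Y" using \<open>2 \<le> card \<A>\<close> eq by (auto simp: card_insert_if)
      ultimately show ?thesis using * \<A> by (auto simp: antichain_in_def)
    qed
    then show "nested \<B> {X, Y}" using XY by (auto simp: nested_def)
  qed
  finally show ?thesis by (simp add: separated_nested_iff[OF assms(1)])
qed

lemma interval_in_path_building_set:
  "a \<le> b \<Longrightarrow> {a..b} \<in> path_building_set n \<longleftrightarrow> b \<le> n"
  by (auto simp: path_building_set_def Icc_eq_Icc)

lemma Un_in_path_building_set:
  fixes a b c d :: nat
  assumes "a \<le> b" "b \<le> n" "c \<le> d" "d \<le> n"
  shows "{a..b} \<union> {c..d} \<in> path_building_set n \<longleftrightarrow> c \<le> Suc b \<and> a \<le> Suc d"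
proof
  assume "{a..b} \<union> {c..d} \<in> path_building_set n"
  then obtain p q where pq: "{a..b} \<union> {c..d} = {p..q}"
    by (auto simp: path_building_set_def)
  have "a \<in> {p..q}" "b \<in> {p..q}" "c \<in> {p..q}" "d \<in> {p..q}"
    using assms unfolding pq[symmetric] by auto
  then have "Suc b \<in> {a..b} \<union> {c..d}" if "c > Suc b"
    unfolding pq using that assms by auto
  moreover have "Suc d \<in> {a..b} \<union> {c..d}" if "a > Suc d"
    unfolding pq using that assms \<open>a \<in> {p..q}\<close> \<open>d \<in> {p..q}\<close> by auto
  ultimately show "c \<le> Suc b \<and> a \<le> Suc d" using assms by (auto simp: not_less[symmetric])
next
  assume "c \<le> Suc b \<and> a \<le> Suc d"
  then have "{a..b} \<union> {c..d} = {min a c..max b d}" using assms by auto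
  then show "{a..b} \<union> {c..d} \<in> path_building_set n"
    using assms by (simp add: interval_in_path_building_set min_def max_def)
qed

text \<open>
  Shifting the right end of an interval by two turns ``neither contained in the other, and overlapping or
  adjacent'' into strict interleaving of endpoints, which is crossing.
\<close>

lemma associahedron_chromatic_number_diagonals:
  "nestohedron_chromatic_number n (path_building_set n) = chromatic_number (diagonals n) crossing"
proof -
  let ?h = "\<lambda>(a, e). {a..e - 2} :: nat set"
  have bij: "bij_betw ?h (diagonals n) (nestohedron_facets n (path_building_set n))"
    unfolding bij_betw_def
  proof
    show "inj_on ?h (diagonals n)"
      by (auto simp: inj_on_def diagonals_def Icc_eq_Icc)
    show "?h ` diagonals n = nestohedron_facets n (path_building_set n)"
    proof
      show "?h ` diagonals n \<subseteq> nestohedron_facets n (path_building_set n)"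
        by (auto simp: diagonals_def nestohedron_facets_def interval_in_path_building_set Icc_eq_Icc)
      show "nestohedron_facets n (path_building_set n) \<subseteq> ?h ` diagonals n"
      proof
        fix X assume "X \<in> nestohedron_facets n (path_building_set n)"
        then have X: "X \<in> path_building_set n" "X \<noteq> {0..n}"
          by (simp_all add: nestohedron_facets_def)
        from X(1) obtain a b where "X = {a..b}" "a \<le> b" "b \<le> n"
          by (auto simp: path_building_set_def)
        moreover from this X(2) have "\<not> (a = 0 \<and> b = n)" by metis
        ultimately show "X \<in> ?h ` diagonals n"
          by (intro image_eqI[of _ _ "(a, b + 2)"]) (auto simp: diagonals_def)
      qed
    qed
  qed
  have "crossing x y \<longleftrightarrow> separated_nested n (path_building_set n) (?h x) (?h y)"
    if xy: "x \<in> diagonals n" "y \<in> diagonals n" for x y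
  proof -
    obtain a e c f where eq: "x = (a, e)" "y = (c, f)" by (cases x, cases y)
    have "?h z \<in> nestohedron_facets n (path_building_set n)" if "z \<in> diagonals n" for z
      by (rule bspec[OF bij_betwE[OF bij] that])
    from this[OF xy(1)] this[OF xy(2)]
    have "separated_nested n (path_building_set n) {a..e - 2} {c..f - 2} \<longleftrightarrow>
      \<not> {a..e - 2} \<subseteq> {c..f - 2} \<and> \<not> {c..f - 2} \<subseteq> {a..e - 2} \<and>
      {a..e - 2} \<union> {c..f - 2} \<in> path_building_set n"
      unfolding eq prod.case by (rule separated_nested_pair[OF building_set_path])
    also have "\<dots> \<longleftrightarrow> crossing x y"
      using xy unfolding eq
      by (subst Un_in_path_building_set) (auto simp: crossing_def diagonals_def)
    finally show ?thesis by (simp add: eq)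
  qed
  then show ?thesis
    unfolding nestohedron_chromatic_number_def
    by (intro chromatic_number_bij_betw[OF bij, symmetric]) auto
qed

section \<open>The diagonals of a polygon, listed by length\<close>

definition diagonal_length :: "nat \<Rightarrow> nat \<times> nat \<Rightarrow> nat" where
  "diagonal_length n = (\<lambda>(a, e). min (e - a) (n + 3 - (e - a)))"

text \<open>
  Position \<open>t = (l - 2) (n + 3) + s\<close> holds the diagonal of length \<open>l\<close> that leads from the vertex \<open>s\<close>
  counterclockwise to \<open>s + l\<close>, reduced modulo \<open>n + 3\<close>. The list has \<open>n (n + 3) div 2\<close> entries, so for odd
  \<open>n\<close> its last row, of length \<open>(n + 3) / 2\<close>, is only half as long as the others: there \<open>s\<close>
  and \<open>s + l\<close> would give the same diagonal.
\<close>

definition nth_diagonal :: "nat \<Rightarrow> nat \<Rightarrow> nat \<times> nat" where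
  "nth_diagonal n t =
     (let s = t mod (n + 3); l = t div (n + 3) + 2
      in if s + l < n + 3 then (s, s + l) else (s + l - (n + 3), s))"

text \<open>
  This locates the end of the list: row \<open>q\<close> is complete if \<open>2 * q + 1 < n\<close>, and cut in half
  if \<open>2 * q + 1 = n\<close>.
\<close>

lemma position_bound_iff:
  fixes n q s :: nat
  assumes "s < n + 3"
  shows "2 * (q * (n + 3) + s) < n * (n + 3) \<longleftrightarrow> 2 * q < n \<and> (2 * q + 1 = n \<longrightarrow> 2 * s < n + 3)"
proof
  assume *: "2 * (q * (n + 3) + s) < n * (n + 3)"
  moreover have "(2 * q) * (n + 3) \<le> 2 * (q * (n + 3) + s)" by (simp add: algebra_simps)
  ultimately have "(2 * q) * (n + 3) < n * (n + 3)" by (rule le_less_trans[rotated])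
  then have "2 * q < n" by (simp only: mult_less_cancel2)
  moreover have "2 * s < n + 3" if "2 * q + 1 = n"
    using * unfolding that[symmetric] by (simp add: algebra_simps)
  ultimately show "2 * q < n \<and> (2 * q + 1 = n \<longrightarrow> 2 * s < n + 3)" by simp
next
  assume *: "2 * q < n \<and> (2 * q + 1 = n \<longrightarrow> 2 * s < n + 3)"
  show "2 * (q * (n + 3) + s) < n * (n + 3)"
  proof (cases "2 * q + 1 = n")
    case True
    then have "n * (n + 3) = 2 * q * (n + 3) + (n + 3)" by (metis add_mult_distrib mult_1)
    then show ?thesis using * True by simp
  next
    case False
    then have "(2 * q + 2) * (n + 3) \<le> n * (n + 3)" using * by (intro mult_right_mono) auto
    moreover have "2 * (q * (n + 3) + s) < (2 * q + 2) * (n + 3)"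
      using assms by (simp add: algebra_simps)
    ultimately show ?thesis by (rule less_le_trans[rotated])
  qed
qed

lemma nth_diagonal_cases:
  assumes "t < n * (n + 3) div 2"
  obtains s l where "t = (l - 2) * (n + 3) + s" "s < n + 3" "t div (n + 3) + 2 = l" "2 \<le> l"
    "2 * l < n + 3 \<or> 2 * l = n + 3 \<and> 2 * s < n + 3"
    "nth_diagonal n t = (if s + l < n + 3 then (s, s + l) else (s + l - (n + 3), s))"
proof
  let ?s = "t mod (n + 3)" and ?q = "t div (n + 3)"
  show "t = (?q + 2 - 2) * (n + 3) + ?s" by (simp only: add_diff_cancel_right' div_mult_mod_eq)
  show "?s < n + 3" by simp
  have "2 * (?q * (n + 3) + ?s) < n * (n + 3)"
    unfolding div_mult_mod_eq using assms by linarith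
  then show "2 * (?q + 2) < n + 3 \<or> 2 * (?q + 2) = n + 3 \<and> 2 * ?s < n + 3"
    using position_bound_iff[of ?s n ?q] by auto
  show "nth_diagonal n t = (if ?s + (?q + 2) < n + 3 then (?s, ?s + (?q + 2)) else (?s + (?q + 2) - (n + 3), ?s))"
    by (simp only: nth_diagonal_def Let_def)
qed simp_all

lemma diagonal_length_nth_diagonal:
  assumes "t < n * (n + 3) div 2"
  shows "diagonal_length n (nth_diagonal n t) = t div (n + 3) + 2"
  by (rule nth_diagonal_cases[OF assms]) (auto simp: diagonal_length_def)

lemma bij_betw_nth_diagonal:
  "bij_betw (nth_diagonal n) {..<n * (n + 3) div 2} (diagonals n)"
  unfolding bij_betw_def
proof
  show "inj_on (nth_diagonal n) {..<n * (n + 3) div 2}"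
  proof (rule inj_onI)
    fix t t' assume t: "t \<in> {..<n * (n + 3) div 2}" and t': "t' \<in> {..<n * (n + 3) div 2}"
      and eq: "nth_diagonal n t = nth_diagonal n t'"
    have "t < n * (n + 3) div 2" using t by simp
    then obtain s l where s: "t = (l - 2) * (n + 3) + s" "s < n + 3" "2 \<le> l"
      "2 * l < n + 3 \<or> 2 * l = n + 3 \<and> 2 * s < n + 3"
      "nth_diagonal n t = (if s + l < n + 3 then (s, s + l) else (s + l - (n + 3), s))"
      by (rule nth_diagonal_cases) (rule that)
    have "t' < n * (n + 3) div 2" using t' by simp
    then obtain s' l' where s': "t' = (l' - 2) * (n + 3) + s'" "s' < n + 3" "2 \<le> l'"
      "2 * l' < n + 3 \<or> 2 * l' = n + 3 \<and> 2 * s' < n + 3"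
      "nth_diagonal n t' = (if s' + l' < n + 3 then (s', s' + l') else (s' + l' - (n + 3), s'))"
      by (rule nth_diagonal_cases) (rule that)
    have "s = s' \<and> l = l'"
      using eq s(2-4) s'(2-4) unfolding s(5) s'(5) by (auto split: if_splits)
    then show "t = t'" using s(1) s'(1) by simp
  qed
  show "nth_diagonal n ` {..<n * (n + 3) div 2} = diagonals n"
  proof
    show "nth_diagonal n ` {..<n * (n + 3) div 2} \<subseteq> diagonals n"
    proof (rule image_subsetI)
      fix t assume "t \<in> {..<n * (n + 3) div 2}"
      then have "t < n * (n + 3) div 2" by simp
      then show "nth_diagonal n t \<in> diagonals n"
        by (rule nth_diagonal_cases) (auto simp: diagonals_def)
    qed
    show "diagonals n \<subseteq> nth_diagonal n ` {..<n * (n + 3) div 2}"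
    proof
      fix x assume "x \<in> diagonals n"
      then obtain a e where x: "x = (a, e)" and ae: "a + 2 \<le> e" "e \<le> n + 2" "\<not> (a = 0 \<and> e = n + 2)"
        by (auto simp: diagonals_def)
      have "\<exists>s l. s < n + 3 \<and> 2 \<le> l \<and> (2 * l < n + 3 \<or> 2 * l = n + 3 \<and> 2 * s < n + 3) \<and>
        (a, e) = (if s + l < n + 3 then (s, s + l) else (s + l - (n + 3), s))"
      proof (cases "2 * (e - a) \<le> n + 3")
        case True
        then show ?thesis using ae by (intro exI[of _ a] exI[of _ "e - a"]) auto
      next
        case False
        then show ?thesis using ae by (intro exI[of _ e] exI[of _ "n + 3 - (e - a)"]) auto
      qed
      then obtain s l where s: "s < n + 3" "2 \<le> l" "2 * l < n + 3 \<or> 2 * l = n + 3 \<and> 2 * s < n + 3"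
        "(a, e) = (if s + l < n + 3 then (s, s + l) else (s + l - (n + 3), s))" by (elim exE conjE)
      let ?t = "(l - 2) * (n + 3) + s"
      have "?t mod (n + 3) = s" "?t div (n + 3) + 2 = l"
        using s(1,2) by (simp_all add: div_mult_self3[of "n + 3"])
      then have t: "nth_diagonal n ?t = x"
        using s(4) x by (simp only: nth_diagonal_def Let_def)
      have "2 * ?t < n * (n + 3)"
        unfolding position_bound_iff[OF s(1)] using s(2,3) by auto
      moreover have "even (n * (n + 3))" by simp
      ultimately have "?t < n * (n + 3) div 2" by presburger
      then show "x \<in> nth_diagonal n ` {..<n * (n + 3) div 2}"
        by (intro image_eqI[of _ _ ?t]) (simp_all only: t lessThan_iff)
    qed
  qed
qed

text \<open>
  Let the diagonal at \<open>t\<close> start at \<open>s\<close> and have length \<open>l\<close>. A later one, less than \<open>l\<close> steps further,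
  starts strictly between \<open>s\<close> and \<open>s + l\<close>. Its length is \<open>l\<close> or \<open>l + 1\<close>, so it ends beyond
  \<open>s + l\<close> without coming round to \<open>s\<close> again. If the row changes in between, position and starting vertex
  wrap around together, and the same comparison applies.
\<close>

lemma crossing_nth_diagonal:
  assumes "t < t'" "t' < n * (n + 3) div 2" "t' < t + (t div (n + 3) + 2)"
  shows "crossing (nth_diagonal n t) (nth_diagonal n t')"
proof -
  have "t < n * (n + 3) div 2" using assms by simp
  then obtain s l where s: "t = (l - 2) * (n + 3) + s" "s < n + 3" "t div (n + 3) + 2 = l" "2 \<le> l"
    "2 * l < n + 3 \<or> 2 * l = n + 3 \<and> 2 * s < n + 3"
    "nth_diagonal n t = (if s + l < n + 3 then (s, s + l) else (s + l - (n + 3), s))"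
    by (rule nth_diagonal_cases) (rule that)
  obtain s' l' where s': "t' = (l' - 2) * (n + 3) + s'" "s' < n + 3" "t' div (n + 3) + 2 = l'" "2 \<le> l'"
    "2 * l' < n + 3 \<or> 2 * l' = n + 3 \<and> 2 * s' < n + 3"
    "nth_diagonal n t' = (if s' + l' < n + 3 then (s', s' + l') else (s' + l' - (n + 3), s'))"
    using assms(2) by (rule nth_diagonal_cases) (rule that)
  obtain q where q: "l = q + 2" using s(4) by (metis le_add_diff_inverse2)
  obtain q' where q': "l' = q' + 2" using s'(4) by (metis le_add_diff_inverse2)
  have "t div (n + 3) \<le> t' div (n + 3)" using assms by (intro div_le_mono) simp
  then have "q \<le> q'" using s(3) s'(3) q q' by simp
  have bound: "t' < t + l" using assms(3) s(3) by simp
  have "q' \<le> q + 1"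
  proof (rule ccontr)
    assume "\<not> q' \<le> q + 1"
    then have "(q + 2) * (n + 3) \<le> q' * (n + 3)" by (intro mult_right_mono) auto
    then show False using bound s s'(1) q q' by (simp add: algebra_simps)
  qed
  then consider "q' = q" | "q' = q + 1" using \<open>q \<le> q'\<close> by linarith
  then show ?thesis
  proof cases
    case 1
    then have "s < s'" "s' < s + l" using assms(1) bound s(1) s'(1) q q' by auto
    then show ?thesis
      using 1 q q' s(2,4,5) s'(2,4,5) unfolding s(6) s'(6) by (auto simp: crossing_def)
  next
    case 2
    then have "s' + (n + 3) < s + l" using bound s(1) s'(1) q q' by (simp add: algebra_simps)
    then show ?thesis
      using 2 q q' s(2,4,5) s'(2,4,5) unfolding s(6) s'(6) by (auto simp: crossing_def)
  qed
qed

section \<open>Colour classes are small\<close>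

text \<open>
  Every other member of the family has one endpoint on each side of the given diagonal, and
  no two members share an endpoint. So the others inject into the vertices of either side.
\<close>

lemma crossing_family_card:
  assumes "C \<subseteq> diagonals n" "\<And>x y. x \<in> C \<Longrightarrow> y \<in> C \<Longrightarrow> x \<noteq> y \<Longrightarrow> crossing x y" "x \<in> C"
  shows "card C \<le> diagonal_length n x"
proof -
  obtain a e where x: "x = (a, e)" by (cases x)
  have ae: "a + 2 \<le> e" "e \<le> n + 2" "\<not> (a = 0 \<and> e = n + 2)"
    using assms(1,3) x by (auto simp: diagonals_def)
  let ?inner = "{a<..<e}" and ?outer = "{..<a} \<union> {e<..n + 2}"
  have fin: "finite C"
    by (rule finite_subset[OF assms(1)], rule finite_subset[of _ "{..n + 2} \<times> {..n + 2}"])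
      (auto simp: diagonals_def)
  have bound: "card C \<le> card I + 1"
    if "finite I" and ends: "\<And>c f. (c, f) \<in> C - {x} \<Longrightarrow> c \<in> I \<or> f \<in> I" for I
  proof -
    define p where "p = (\<lambda>(c, f). if c \<in> I then c else f :: nat)"
    have "inj_on p (C - {x})"
    proof (rule inj_onI)
      fix y z assume y: "y \<in> C - {x}" and z: "z \<in> C - {x}" and eq: "p y = p z"
      show "y = z"
      proof (rule ccontr)
        assume "y \<noteq> z"
        then have "crossing y z" using assms(2) y z by simp
        then show False using eq by (auto simp: crossing_def p_def split: if_splits)
      qed
    qed
    moreover have "p ` (C - {x}) \<subseteq> I"
    proof (rule image_subsetI)
      fix y assume y: "y \<in> C - {x}"
      obtain c f where "y = (c, f)" by (cases y)
      then show "p y \<in> I" using ends[of c f] y by (auto simp: p_def)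
    qed
    ultimately have "card (C - {x}) \<le> card I" using that(1) by (intro card_inj_on_le[of p])
    then show ?thesis using assms(3) fin by (simp add: card_Diff_singleton_if)
  qed
  have cross: "crossing x (c, f)" "f \<le> n + 2" if "(c, f) \<in> C - {x}" for c f
    using that assms(1) assms(2)[OF assms(3), of "(c, f)"] by (auto simp: diagonals_def)
  have "card C \<le> card ?inner + 1"
  proof (rule bound)
    fix c f assume cf: "(c, f) \<in> C - {x}"
    show "c \<in> ?inner \<or> f \<in> ?inner"
      using cross[OF cf] x by (auto simp: crossing_def)
  qed simp
  moreover have "card C \<le> card ?outer + 1"
  proof (rule bound)
    fix c f assume cf: "(c, f) \<in> C - {x}"
    show "c \<in> ?outer \<or> f \<in> ?outer"
      using cross[OF cf] x by (auto simp: crossing_def)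
  qed simp
  moreover have "card ?outer = a + (n + 2 - e)"
    using ae by (subst card_Un_disjoint) auto
  ultimately show ?thesis using ae by (auto simp: x diagonal_length_def)
qed

text \<open>
  Let \<open>l\<close> be the least \<open>len\<close> in a colour class that meets \<open>{x. len x \<le> i}\<close>. The class has at most \<open>l\<close>
  members, and it is seen among the items of length at most \<open>j\<close> for only \<open>i - l\<close> values of
  \<open>j < i\<close>. So it contributes at most \<open>i\<close> to the left-hand side. Summing over \<open>j\<close> in this way
  replaces weighted sums of shortest lengths by plain numbers of colours.
\<close>

lemma colour_class_count:
  fixes len :: "'a \<Rightarrow> nat"
  assumes fin: "finite U" and small: "\<And>x. x \<in> U \<Longrightarrow> card {y \<in> U. g y = g x} \<le> len x"
  shows "card {x \<in> U. len x \<le> i} + (\<Sum>j<i. card (g ` {x \<in> U. len x \<le> j}))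
           \<le> i * card (g ` {x \<in> U. len x \<le> i})"
proof -
  let ?E = "\<lambda>j. {x \<in> U. len x \<le> j}"
  let ?K = "g ` ?E i"
  have finK: "finite ?K" using fin by simp
  have "card (?E i) = (\<Sum>c\<in>?K. card {y \<in> ?E i. g y = c})"
    using sum.image_gen[of "?E i" "\<lambda>_. 1::nat" g] fin by simp
  moreover have "(\<Sum>j<i. card (g ` ?E j)) = (\<Sum>c\<in>?K. card {j. j < i \<and> c \<in> g ` ?E j})"
  proof -
    have "card (g ` ?E j) = (\<Sum>c\<in>?K. of_bool (c \<in> g ` ?E j))" if "j < i" for j
    proof -
      have "g ` ?E j \<subseteq> ?K" using that by (intro image_mono) auto
      then have "?K \<inter> {c. c \<in> g ` ?E j} = g ` ?E j" by auto
      then show ?thesis using finK by (simp add: sum_of_bool_eq)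
    qed
    then have "(\<Sum>j<i. card (g ` ?E j)) = (\<Sum>j<i. \<Sum>c\<in>?K. of_bool (c \<in> g ` ?E j))" by simp
    also have "\<dots> = (\<Sum>c\<in>?K. \<Sum>j<i. of_bool (c \<in> g ` ?E j))" by (rule sum.swap)
    also have "\<dots> = (\<Sum>c\<in>?K. card {j. j < i \<and> c \<in> g ` ?E j})"
    proof (rule sum.cong[OF refl])
      fix c
      have "{..<i} \<inter> {j. c \<in> g ` ?E j} = {j. j < i \<and> c \<in> g ` ?E j}" by auto
      then show "(\<Sum>j<i. of_bool (c \<in> g ` ?E j)) = card {j. j < i \<and> c \<in> g ` ?E j}"
        by (simp add: sum_of_bool_eq)
    qed
    finally show ?thesis .
  qed
  ultimately have "card (?E i) + (\<Sum>j<i. card (g ` ?E j)) =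
      (\<Sum>c\<in>?K. card {y \<in> ?E i. g y = c} + card {j. j < i \<and> c \<in> g ` ?E j})"
    by (simp only: sum.distrib)
  also have "\<dots> \<le> (\<Sum>c\<in>?K. i)"
  proof (rule sum_mono)
    fix c assume "c \<in> ?K"
    then obtain x' where "x' \<in> ?E i \<and> g x' = c" by auto
    then obtain x where x: "x \<in> ?E i" "g x = c" and least: "\<And>y. y \<in> ?E i \<Longrightarrow> g y = c \<Longrightarrow> len x \<le> len y"
      using ex_has_least_nat[of "\<lambda>x. x \<in> ?E i \<and> g x = c" x' len] by auto
    have "card {y \<in> ?E i. g y = c} \<le> card {y \<in> U. g y = g x}"
      using fin x by (intro card_mono) auto
    also have "\<dots> \<le> len x" using small[of x] x by simp
    finally have 1: "card {y \<in> ?E i. g y = c} \<le> len x" .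
    have "{j. j < i \<and> c \<in> g ` ?E j} \<subseteq> {len x..<i}"
    proof
      fix j assume "j \<in> {j. j < i \<and> c \<in> g ` ?E j}"
      then obtain y where "j < i" "y \<in> ?E j" "g y = c" by auto
      then show "j \<in> {len x..<i}" using least[of y] by auto
    qed
    then have "card {j. j < i \<and> c \<in> g ` ?E j} \<le> i - len x"
      using card_mono[of "{len x..<i}"] by fastforce
    then show "card {y \<in> ?E i. g y = c} + card {j. j < i \<and> c \<in> g ` ?E j} \<le> i"
      using 1 x by auto
  qed
  finally show ?thesis by (simp add: mult.commute)
qed

section \<open>Greedy sequences\<close>

text \<open>
  Read \<open>a j\<close> as the number of colours reserved for families of \<open>j\<close> diagonals whose shortest member has
  length \<open>j\<close>. Then \<open>slots a i\<close> is the number of diagonals that the families up to \<open>i\<close> can hold.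
\<close>

definition slots :: "(nat \<Rightarrow> nat) \<Rightarrow> nat \<Rightarrow> nat" where
  "slots a i = (\<Sum>j = 2..i. j * a j)"

definition colours :: "(nat \<Rightarrow> nat) \<Rightarrow> nat \<Rightarrow> nat" where
  "colours a i = (\<Sum>j = 2..i. a j)"

lemma slots_simps [simp]:
  "slots a 0 = 0" "slots a (Suc 0) = 0"
  "1 \<le> i \<Longrightarrow> slots a (Suc i) = slots a i + Suc i * a (Suc i)"
  by (simp_all add: slots_def)

lemma colours_simps [simp]:
  "colours a 0 = 0" "colours a (Suc 0) = 0"
  "1 \<le> i \<Longrightarrow> colours a (Suc i) = colours a i + a (Suc i)"
  by (simp_all add: colours_def)

text \<open>
  Summation by parts; the greedy choice attains equality where \<open>colour_class_count\<close> gives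
  an inequality.
\<close>

lemma slots_plus_sum_colours: "slots a i + (\<Sum>j<i. colours a j) = i * colours a i"
proof (induction i)
  case (Suc i)
  then show ?case by (cases "i = 0") (simp_all add: algebra_simps)
qed simp

text \<open>
  Fewer colours below \<open>i\<close> never help: by \<open>slots_plus_sum_colours\<close>, the bound that \<open>count\<close> puts on \<open>i * S i\<close>
  exceeds \<open>i * colours a i - i\<close> as soon as \<open>S\<close> dominates \<open>colours a\<close> below \<open>i\<close>, and the defect \<open>i\<close>
  is absorbed because \<open>S i\<close> is an integer.
\<close>

lemma colours_lower_bound:
  assumes greedy: "\<And>i. 2 \<le> i \<Longrightarrow> i \<le> m \<Longrightarrow> slots a i < d i + i"
    and count: "\<And>i. d i + (\<Sum>j<i. S j) \<le> i * S i"
  shows "i \<le> m \<Longrightarrow> colours a i \<le> S i"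
proof (induction i rule: less_induct)
  case (less i)
  show ?case
  proof (cases "2 \<le> i")
    case True
    have "(\<Sum>j<i. colours a j) \<le> (\<Sum>j<i. S j)"
      using less by (intro sum_mono) simp
    then have "i * colours a i < i * S i + i"
      using greedy[OF True less.prems] count[of i] slots_plus_sum_colours[of a i] by linarith
    then have "i * colours a i < i * (S i + 1)" by simp
    then show ?thesis by (simp only: mult_less_cancel1) simp
  next
    case False
    then have "i = 0 \<or> i = Suc 0" by linarith
    then show ?thesis by auto
  qed
qed

text \<open>
  Positions from \<open>slots a (i - 1)\<close> up to \<open>slots a i\<close> are cut into \<open>a i\<close> blocks of \<open>i\<close> consecutive
  positions, one colour each. By \<open>reach\<close> these positions lie at or beyond the row of
  length \<open>i\<close>, so two positions of one block are fewer steps apart than the length of the first, which is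
  what \<open>crossing_nth_diagonal\<close> requires.
\<close>

lemma greedy_blocks:
  assumes "0 < p" and reach: "\<And>i. 1 \<le> i \<Longrightarrow> i < m \<Longrightarrow> (i - 1) * p \<le> slots a i"
  shows "k \<le> m \<Longrightarrow> \<exists>g. (\<forall>t < slots a k. g t < colours a k) \<and>
    (\<forall>t t'. t < t' \<longrightarrow> t' < slots a k \<longrightarrow> g t = g t' \<longrightarrow> t' < t + (t div p + 2))"
proof (induction k)
  case (Suc k)
  show ?case
  proof (cases "k = 0")
    case False
    let ?P = "slots a k" and ?i = "Suc k"
    obtain g where g: "\<And>t. t < ?P \<Longrightarrow> g t < colours a k"
      "\<And>t t'. t < t' \<Longrightarrow> t' < ?P \<Longrightarrow> g t = g t' \<Longrightarrow> t' < t + (t div p + 2)"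
      using Suc by auto
    define g' where "g' t = (if t < ?P then g t else colours a k + (t - ?P) div ?i)" for t
    have "g' t < colours a ?i" if "t < slots a ?i" for t
    proof (cases "t < ?P")
      case True
      then show ?thesis using g(1)[of t] False by (simp add: g'_def)
    next
      case new: False
      have "t - ?P < a ?i * ?i" using that new False by (simp add: mult.commute)
      then have "(t - ?P) div ?i < a ?i" by (rule less_mult_imp_div_less)
      then show ?thesis using new False by (simp add: g'_def)
    qed
    moreover have "t' < t + (t div p + 2)"
      if t: "t < t'" "t' < slots a ?i" "g' t = g' t'" for t t'
    proof (cases "t < ?P")
      case old: True
      show ?thesis
      proof (cases "t' < ?P")
        case True
        then show ?thesis using g(2)[of t t'] t old by (simp add: g'_def)
      next
        case False
        then show ?thesis using g(1)[of t] t old by (simp add: g'_def)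
      qed
    next
      case new: False
      let ?q = "(t - ?P) div ?i"
      have "?q = (t' - ?P) div ?i" using t new by (simp add: g'_def)
      then have "t' - ?P < ?q * ?i + ?i"
        using dividend_less_div_times[of ?i "t' - ?P"] by simp
      moreover have "?q * ?i \<le> t - ?P" by (rule div_times_less_eq_dividend)
      ultimately have "t' < t + ?i" using new t by linarith
      moreover have "k - 1 \<le> t div p"
      proof -
        have "(k - 1) * p \<le> t" using reach[of k] Suc.prems False new by simp
        then have "(k - 1) * p div p \<le> t div p" by (rule div_le_mono)
        then show ?thesis using assms(1) by simp
      qed
      ultimately show ?thesis using False by linarith
    qed
    ultimately show ?thesis by (intro exI[of _ g']) auto
  qed simp
qed simp

text \<open>
  Here \<open>d i\<close> is the number of diagonals of length at most \<open>i\<close>. The hypothesis \<open>greedy\<close> says that the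
  families up to \<open>i\<close> have room for all of these, and that one family of \<open>i\<close> fewer would not.
\<close>

lemma chromatic_number_diagonals:
  fixes n :: nat
  defines "d \<equiv> \<lambda>i. min ((i - 1) * (n + 3)) (n * (n + 3) div 2)" and "m \<equiv> (n + 3) div 2"
  assumes greedy: "\<And>i. 2 \<le> i \<Longrightarrow> i \<le> m \<Longrightarrow> d i \<le> slots a i \<and> slots a i < d i + i" and "1 \<le> n"
  shows "chromatic_number (diagonals n) crossing = colours a m"
proof -
  let ?L = "n * (n + 3) div 2"
  let ?cross = "\<lambda>t t'. crossing (nth_diagonal n t) (nth_diagonal n t')"
  have "chromatic_number {..<?L} ?cross = colours a m"
    unfolding chromatic_number_def
  proof (rule Least_equality)
    \<comment> \<open>Rows below the last one are complete, so the minimum in \<open>d i\<close> is its first argument there.\<close>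
    have "(i - 1) * (n + 3) \<le> slots a i" if i: "1 \<le> i" "i < m" for i
    proof (cases "i = 1")
      case False
      have "2 * (i - 1) \<le> n" using i by (simp add: m_def)
      then have "2 * (i - 1) * (n + 3) \<le> n * (n + 3)" by (rule mult_right_mono) simp
      then have "(i - 1) * (n + 3) \<le> ?L" by linarith
      then have "d i = (i - 1) * (n + 3)" by (simp add: d_def)
      then show ?thesis using greedy[of i] False i by simp
    qed simp
    then obtain g where g: "\<And>t. t < slots a m \<Longrightarrow> g t < colours a m"
      "\<And>t t'. t < t' \<Longrightarrow> t' < slots a m \<Longrightarrow> g t = g t' \<Longrightarrow> t' < t + (t div (n + 3) + 2)"
      using greedy_blocks[of "n + 3" m a m] by auto
    have "2 \<le> m" using \<open>1 \<le> n\<close> by (simp add: m_def)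
    have "?L \<le> (m - 1) * (n + 3)"
    proof -
      have "n \<le> 2 * (m - 1)" by (simp add: m_def)
      then have "n * (n + 3) \<le> 2 * (m - 1) * (n + 3)" by (rule mult_right_mono) simp
      then show ?thesis by linarith
    qed
    then have "?L \<le> slots a m" using greedy[OF \<open>2 \<le> m\<close> order_refl] by (simp add: d_def)
    have "?cross t t'" if t: "t < ?L" "t' < ?L" "t \<noteq> t'" "g t = g t'" for t t'
    proof (cases "t < t'")
      case True
      then show ?thesis
        using t g(2)[of t t'] \<open>?L \<le> slots a m\<close> by (intro crossing_nth_diagonal) auto
    next
      case False
      then have "?cross t' t"
        using t g(2)[of t' t] \<open>?L \<le> slots a m\<close> by (intro crossing_nth_diagonal) auto
      then show ?thesis by (auto simp: crossing_def split: prod.splits)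
    qed
    moreover have "Suc (g t) \<in> {1..colours a m}" if "t \<in> {..<?L}" for t
      using g(1)[of t] that \<open>?L \<le> slots a m\<close> by simp
    ultimately have "proper_colouring {..<?L} ?cross (colours a m) (\<lambda>t. Suc (g t))"
      unfolding proper_colouring_def by (intro conjI Pi_I ballI impI) simp_all
    then show "\<exists>f. proper_colouring {..<?L} ?cross (colours a m) f" by blast
  next
    fix c assume "\<exists>f. proper_colouring {..<?L} ?cross c f"
    then obtain f where f: "proper_colouring {..<?L} ?cross c f" ..
    let ?len = "\<lambda>t. t div (n + 3) + 2"
    let ?S = "\<lambda>i. card (f ` {t \<in> {..<?L}. ?len t \<le> i})"
    have "card {t' \<in> {..<?L}. f t' = f t} \<le> ?len t" if "t \<in> {..<?L}" for t
    proof -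
      let ?C = "{t' \<in> {..<?L}. f t' = f t}"
      have "card ?C = card (nth_diagonal n ` ?C)"
        by (intro card_image[symmetric] inj_on_subset[OF bij_betw_imp_inj_on[OF bij_betw_nth_diagonal]]) auto
      also have "\<dots> \<le> diagonal_length n (nth_diagonal n t)"
      proof (rule crossing_family_card)
        show "nth_diagonal n ` ?C \<subseteq> diagonals n"
          using bij_betwE[OF bij_betw_nth_diagonal[of n]] by auto
        show "nth_diagonal n t \<in> nth_diagonal n ` ?C" using that by auto
        fix x y assume "x \<in> nth_diagonal n ` ?C" "y \<in> nth_diagonal n ` ?C" "x \<noteq> y"
        then obtain u v where uv: "u \<in> ?C" "v \<in> ?C" "x = nth_diagonal n u" "y = nth_diagonal n v"
          by (elim imageE)
        moreover have "u \<noteq> v" using uv(3,4) \<open>x \<noteq> y\<close> by metis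
        ultimately show "crossing x y" using f unfolding proper_colouring_def by simp
      qed
      also have "\<dots> = ?len t" using that by (simp add: diagonal_length_nth_diagonal)
      finally show ?thesis .
    qed
    then have count: "card {t \<in> {..<?L}. ?len t \<le> i} + (\<Sum>j<i. ?S j) \<le> i * ?S i" for i
      by (intro colour_class_count) simp_all
    have card_d: "card {t \<in> {..<?L}. ?len t \<le> i} = d i" for i
    proof -
      have "?len t \<le> i \<longleftrightarrow> t < (i - 1) * (n + 3)" for t
      proof -
        have "?len t \<le> i \<longleftrightarrow> t div (n + 3) < i - 1" by linarith
        also have "\<dots> \<longleftrightarrow> t < (i - 1) * (n + 3)" by (rule div_less_iff_less_mult) simp
        finally show ?thesis .
      qed
      then have "{t \<in> {..<?L}. ?len t \<le> i} = {..<d i}"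
        by (intro set_eqI) (simp only: mem_Collect_eq lessThan_iff d_def min_less_iff_conj conj_commute)
      then show ?thesis by (simp only: card_lessThan)
    qed
    have "colours a m \<le> ?S m"
    proof (rule colours_lower_bound)
      show "slots a i < d i + i" if "2 \<le> i" "i \<le> m" for i
        using greedy[OF that] by (rule conjunct2)
      show "d i + (\<Sum>j<i. ?S j) \<le> i * ?S i" for i
        using count[of i] by (simp only: card_d)
    qed (rule order_refl)
    also have "\<dots> \<le> card {1..c}"
    proof (rule card_mono)
      have "f \<in> {..<?L} \<rightarrow> {1..c}" using f by (simp add: proper_colouring_def)
      then show "f ` {t \<in> {..<?L}. ?len t \<le> m} \<subseteq> {1..c}" by auto
    qed simp
    finally show "colours a m \<le> c" by simp
  qed
  then show ?thesis
    using chromatic_number_bij_betw[OF bij_betw_nth_diagonal, of n ?cross crossing] by simp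
qed

section \<open>The recursion is greedy\<close>

text \<open>
  The index is shifted by two because the recursion starts at \<open>seqB n 2 = 0\<close>.
\<close>

lemma seqB_eq: "seqB n (i + 2) = int i * (int n + 3) - (\<Sum>j = 2..Suc i. int j * seqA n j)"
proof (induction i)
  case 0
  then show ?case by (simp add: seqB.simps)
next
  case (Suc i)
  have "seqB n (Suc i + 2) = int n + 3 + seqB n (i + 2) - (int i + 2) * seqA n (i + 2)"
    by (subst seqB.simps) simp
  moreover have "int (Suc i) * (int n + 3) = int i * (int n + 3) + (int n + 3)"
    by (simp add: algebra_simps)
  moreover have "(\<Sum>j = 2..Suc (Suc i). int j * seqA n j) =
      (\<Sum>j = 2..Suc i. int j * seqA n j) + (int i + 2) * seqA n (i + 2)"
    by simp
  ultimately show ?case by (simp only: Suc.IH)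
qed

lemma ceiling_half: "\<lceil>real n / 2\<rceil> = int ((n + 1) div 2)"
  by (cases "even n") (auto elim!: evenE oddE intro!: ceiling_unique simp: add_divide_distrib)

lemma ceiling_div_bounds:
  fixes r k :: int
  assumes "0 < k"
  shows "r \<le> k * \<lceil>real_of_int r / real_of_int k\<rceil>" "k * \<lceil>real_of_int r / real_of_int k\<rceil> < r + k"
proof -
  have "\<lceil>real_of_int r / real_of_int k\<rceil> = - (- r div k)" by (simp add: ceiling_divide_eq_div)
  then have "k * \<lceil>real_of_int r / real_of_int k\<rceil> = r + (- r) mod k"
    using mult_div_mod_eq[of k "- r"] by (simp only: mult_minus_right)
  moreover have "0 \<le> (- r) mod k" "(- r) mod k < k" using assms by simp_all
  ultimately show "r \<le> k * \<lceil>real_of_int r / real_of_int k\<rceil>" "k * \<lceil>real_of_int r / real_of_int k\<rceil> < r + k"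
    by simp_all
qed

text \<open>
  While row \<open>i\<close> is complete, \<open>n + 3 + seqB n i\<close> counts the diagonals of length at most \<open>i\<close> that the
  earlier families have no room for, and the ceiling is the least number of families of \<open>i\<close>
  that holds them. The exceptional value \<open>1\<close> belongs to the half row of length \<open>i = (n + 3) / 2\<close>: it
  has just \<open>i\<close> members, and fewer than \<open>i - 1\<close> of them are held by earlier families, so exactly one more
  family is needed. The induction starts at \<open>1\<close>, where all quantities vanish.
\<close>

lemma seqA_greedy:
  fixes n :: nat
  defines "d \<equiv> \<lambda>i. min ((i - 1) * (n + 3)) (n * (n + 3) div 2)"
  assumes "1 \<le> i" "i \<le> (n + 3) div 2"
  shows "(\<forall>j\<in>{2..i}. 0 \<le> seqA n j) \<and> int (d i) \<le> (\<Sum>j = 2..i. int j * seqA n j) \<and>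
    (\<Sum>j = 2..i. int j * seqA n j) < int (d i) + int i"
  using assms(2,3)
proof (induction i rule: dec_induct)
  case base
  then show ?case by (simp add: d_def)
next
  case (step k)
  let ?Q = "\<lambda>i. \<Sum>j = 2..i. int j * seqA n j"
  have d_eq: "d i = (i - 1) * (n + 3)" if "2 * (i - 1) \<le> n" for i
  proof -
    have "2 * (i - 1) * (n + 3) \<le> n * (n + 3)" using that by (rule mult_right_mono) simp
    then have "(i - 1) * (n + 3) \<le> n * (n + 3) div 2" by linarith
    then show ?thesis by (simp add: d_def)
  qed
  have "int (d k) = (int k - 1) * (int n + 3)"
    using step.hyps step.prems by (subst d_eq) (auto simp: of_nat_diff)
  then have IH: "\<forall>j\<in>{2..k}. 0 \<le> seqA n j" "(int k - 1) * (int n + 3) \<le> ?Q k"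
    "?Q k < (int k - 1) * (int n + 3) + int k"
    using step.IH step.prems by auto
  have Q: "?Q (Suc k) = ?Q k + int (Suc k) * seqA n (Suc k)" using step.hyps by simp
  have B: "seqB n (Suc k) = (int k - 1) * (int n + 3) - ?Q k"
    using seqB_eq[of n "k - 1"] step.hyps by (simp add: of_nat_diff)
  have "0 \<le> seqA n (Suc k) \<and> int (d (Suc k)) \<le> ?Q (Suc k) \<and> ?Q (Suc k) < int (d (Suc k)) + int (Suc k)"
  proof (cases "even n \<or> int (Suc k) \<le> \<lceil>real n / 2\<rceil>")
    case True
    let ?r = "int n + 3 + seqB n (Suc k)"
    have A: "seqA n (Suc k) = \<lceil>real_of_int ?r / real_of_int (int (Suc k))\<rceil>"
      using True by (subst seqA.simps) simp
    have "2 * (Suc k - 1) \<le> n"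
      using True step.prems unfolding ceiling_half by (auto elim!: evenE)
    then have "int (d (Suc k)) = int k * (int n + 3)" by (subst d_eq) auto
    moreover have "?r = int k * (int n + 3) - ?Q k" unfolding B by (simp add: algebra_simps)
    moreover have "?r \<le> int (Suc k) * seqA n (Suc k)" "int (Suc k) * seqA n (Suc k) < ?r + int (Suc k)"
      unfolding A by (rule ceiling_div_bounds; simp)+
    moreover have "0 \<le> seqA n (Suc k)"
    proof -
      have "0 < ?r" using IH(3) step.prems unfolding B by simp
      then have "0 < int (Suc k) * seqA n (Suc k)"
        using \<open>?r \<le> int (Suc k) * seqA n (Suc k)\<close> by linarith
      then show ?thesis by (simp add: zero_less_mult_iff)
    qed
    ultimately show ?thesis unfolding Q by linarith
  next
    case False
    then have "seqA n (Suc k) = 1" by (subst seqA.simps) simp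
    moreover have n: "n = 2 * k - 1" "odd n"
      using False step.prems unfolding ceiling_half by (auto elim!: oddE)
    have "int (d (Suc k)) = (int k - 1) * (int n + 3) + int (Suc k)"
    proof -
      obtain q where k: "k = Suc q" using step.hyps by (cases k) auto
      have "n * (n + 3) = 2 * ((2 * q + 1) * (q + 2))" using n k by (simp add: algebra_simps)
      then have "n * (n + 3) div 2 = (2 * q + 1) * (q + 2)" by simp
      moreover have "(2 * q + 1) * (q + 2) \<le> Suc q * (n + 3)" using n k by (simp add: algebra_simps)
      ultimately have "d (Suc k) = (2 * q + 1) * (q + 2)" by (simp add: d_def k)
      then show ?thesis using n k by (simp add: algebra_simps)
    qed
    ultimately show ?thesis unfolding Q using IH(2,3) by simp
  qed
  moreover have "{2..Suc k} = insert (Suc k) {2..k}" using step.hyps by auto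
  ultimately show ?case using IH(1) by simp
qed

lemma chromatic_number_diagonals_recursion:
  assumes "1 \<le> n"
  shows "int (chromatic_number (diagonals n) crossing) = (\<Sum>i = 2..nat \<lceil>real n / 2\<rceil> + 1. seqA n i)"
proof -
  let ?m = "(n + 3) div 2" and ?a = "\<lambda>i. nat (seqA n i)"
  have nonneg: "0 \<le> seqA n j" if "j \<in> {2..?m}" for j
    using seqA_greedy[of ?m n] that assms by auto
  have slots: "int (slots ?a i) = (\<Sum>j = 2..i. int j * seqA n j)" if "i \<le> ?m" for i
    using nonneg that by (simp add: slots_def)
  have "min ((i - 1) * (n + 3)) (n * (n + 3) div 2) \<le> slots ?a i \<and>
      slots ?a i < min ((i - 1) * (n + 3)) (n * (n + 3) div 2) + i"
    if "2 \<le> i" "i \<le> ?m" for i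
  proof -
    have "int (min ((i - 1) * (n + 3)) (n * (n + 3) div 2)) \<le> int (slots ?a i) \<and>
      int (slots ?a i) < int (min ((i - 1) * (n + 3)) (n * (n + 3) div 2)) + int i"
      using seqA_greedy[of i n] that slots[OF that(2)] by simp
    then show ?thesis by linarith
  qed
  then have "chromatic_number (diagonals n) crossing = colours ?a ?m"
    using assms by (rule chromatic_number_diagonals)
  moreover have "int (colours ?a ?m) = (\<Sum>i = 2..?m. seqA n i)"
    using nonneg by (simp add: colours_def)
  moreover have "nat \<lceil>real n / 2\<rceil> + 1 = ?m" by (simp add: ceiling_half)
  ultimately show ?thesis by (simp only:)
qed

theorem theorem4p8:
  fixes n :: nat
  assumes "n \<ge> 1"
  shows "int (nestohedron_chromatic_number n (path_building_set n))
           = (\<Sum>i = 2..nat \<lceil>real n / 2\<rceil> + 1. seqA n i) \<and>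
         (\<forall>P :: 'a::euclidean_space set. associahedron n P \<longrightarrow>
           int (polytope_chromatic_number P) = (\<Sum>i = 2..nat \<lceil>real n / 2\<rceil> + 1. seqA n i))"
proof -
  have "int (nestohedron_chromatic_number n (path_building_set n))
      = (\<Sum>i = 2..nat \<lceil>real n / 2\<rceil> + 1. seqA n i)"
    unfolding associahedron_chromatic_number_diagonals
    by (rule chromatic_number_diagonals_recursion[OF assms])
  moreover have "polytope_chromatic_number P = nestohedron_chromatic_number n (path_building_set n)"
    if "associahedron n P" for P :: "'a set"
    using that building_set_path unfolding associahedron_def
    by (rule polytope_chromatic_number_nestohedron)
  ultimately show ?thesis by (intro conjI allI impI) (simp_all only:)
qed

end
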